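(* Let $\mathcal{H}_A$ and $\mathcal{H}_B$ be complex Hilbert spaces of finite dimensions $r\ge 2$ and $s\ge 2$, respectively. A probabilistic masker that can mask all the states in $\mathbb{P}(\mathcal{H}_A)$ is impossible. That is, there do not exist a unit vector $|b\rangle\in\mathcal{H}_B$, an invertible linear operator $L:\mathcal{H}_A\otimes\mathcal{H}_B\to\mathcal{H}_A\otimes\mathcal{H}_B$ with $L^\dagger L\le I$, and density matrices $\rho_A$ on $\mathcal{H}_A$ and $\rho_B$ on $\mathcal{H}_B$ such that for every unit vector $|a\rangle\in\mathcal{H}_A$, writing $L(|a\rangle\otimes|b\rangle)=p_a|\Psi_a\rangle$ with $p_a>0$ and $|\Psi_a\rangle\in\mathcal{H}_A\otimes\mathcal{H}_B$ a unit vector, one has $$\operatorname{Tr}_B\big(|\Psi_a\rangle\langle\Psi_a|\big)=\rho_A\quad\text{and}\quad \operatorname{Tr}_A\big(|\Psi_a\rangle\langle\Psi_a|\big)=\rho_B .$$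
   Context: $\mathbb{P}(\mathcal{H})$ denotes the set of pure states (unit vectors) of a Hilbert space $\mathcal{H}$. $\operatorname{Tr}_A$ and $\operatorname{Tr}_B$ are the partial traces over $\mathcal{H}_A$ and $\mathcal{H}_B$. A probabilistic masker for a set $\mathcal{A}$ of pure states $|a_k\rangle\in\mathcal{H}_A$ consists of a fixed pure ancilla state $|b\rangle\in\mathcal{H}_B$ and an invertible, trace-decreasing (i.e. $L^\dagger L\le I$) linear transformation $L$ that maps each $|a_k\rangle|b\rangle$ to $p_k|\Psi_k\rangle$ with $|\Psi_k\rangle\in\mathbb{P}(\mathcal{H}_A\otimes\mathcal{H}_B)$, such that all the $|\Psi_k\rangle$ have the same marginal $\rho_A$ on $\mathcal{H}_A$ and the same marginal $\rho_B$ on $\mathcal{H}_B$, independently of $k$. *)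

theory Defs
  imports "HOL-Analysis.Analysis"
begin

text \<open>
  A complex Hilbert space of finite dimension r is modelled as \<open>complex ^ 'r\<close> with
  \<open>CARD('r) = r\<close>; the library norm on it is the Hilbert space norm (lemma \<open>cinner_self\<close>).
  The tensor product of \<open>complex ^ 'r\<close> and \<open>complex ^ 's\<close> is \<open>complex ^ ('r \<times> 's)\<close>, the
  product basis being indexed by pairs. Linear operators are given by their matrices
  (row index first).
\<close>

text \<open>The sesquilinear inner product, conjugate linear in the first argument; the
  library's \<open>inner\<close> on this type is only its real part.\<close>

definition cinner :: "complex ^ 'n \<Rightarrow> complex ^ 'n \<Rightarrow> complex" where
  "cinner u v = (\<Sum>i\<in>UNIV. cnj (u $ i) * v $ i)"

definition adjoint_matrix :: "complex ^ 'n ^ 'm \<Rightarrow> complex ^ 'm ^ 'n" where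
  "adjoint_matrix A = (\<chi> i j. cnj (A $ j $ i))"

definition pos_semidef :: "complex ^ 'n ^ 'n \<Rightarrow> bool" where
  "pos_semidef A \<longleftrightarrow> adjoint_matrix A = A \<and> (\<forall>v. 0 \<le> Re (cinner v (A *v v)))"

definition loewner_le :: "complex ^ 'n ^ 'n \<Rightarrow> complex ^ 'n ^ 'n \<Rightarrow> bool" where
  "loewner_le A B \<longleftrightarrow> pos_semidef (B - A)"

definition density_matrix :: "complex ^ 'n ^ 'n \<Rightarrow> bool" where
  "density_matrix \<rho> \<longleftrightarrow> pos_semidef \<rho> \<and> trace \<rho> = 1"

definition pure_states :: "(complex ^ 'n) set" where
  "pure_states = {\<psi>. norm \<psi> = 1}"

definition tensor_vec :: "complex ^ 'r \<Rightarrow> complex ^ 's \<Rightarrow> complex ^ ('r::finite \<times> 's::finite)" where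
  "tensor_vec a b = (\<chi> k. a $ fst k * b $ snd k)"

text \<open>The operator \<open>|\<psi>\<rangle>\<langle>\<psi>|\<close>.\<close>

definition ketbra :: "complex ^ 'n \<Rightarrow> complex ^ 'n ^ 'n" where
  "ketbra \<psi> = (\<chi> i j. \<psi> $ i * cnj (\<psi> $ j))"

text \<open>\<open>ptrace_A\<close> and \<open>ptrace_B\<close> trace out the first and the second tensor factor,
  respectively.\<close>

definition ptrace_A :: "complex ^ ('r::finite \<times> 's::finite) ^ ('r::finite \<times> 's::finite) \<Rightarrow> complex ^ 's ^ 's" where
  "ptrace_A M = (\<chi> i j. \<Sum>k\<in>UNIV. M $ (k, i) $ (k, j))"

definition ptrace_B :: "complex ^ ('r::finite \<times> 's::finite) ^ ('r::finite \<times> 's::finite) \<Rightarrow> complex ^ 'r ^ 'r" where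
  "ptrace_B M = (\<chi> i j. \<Sum>k\<in>UNIV. M $ (i, k) $ (j, k))"

text \<open>
  \<open>probabilistic_masker S b L \<rho>A \<rho>B\<close>: the ancilla \<open>b\<close> and the operator \<open>L\<close> mask every state
  of the set \<open>S\<close>, with \<open>\<rho>A\<close> and \<open>\<rho>B\<close> as the common marginals. Since \<open>p > 0\<close> and \<open>\<Psi>\<close> is a
  unit vector, both are determined by \<open>L (a \<otimes> b)\<close>.
\<close>

definition probabilistic_masker ::
  "(complex ^ 'r) set \<Rightarrow> complex ^ 's \<Rightarrow> complex ^ ('r::finite \<times> 's::finite) ^ ('r \<times> 's)
    \<Rightarrow> complex ^ 'r ^ 'r \<Rightarrow> complex ^ 's ^ 's \<Rightarrow> bool" where
  "probabilistic_masker S b L \<rho>A \<rho>B \<longleftrightarrow>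
     S \<subseteq> pure_states \<and> b \<in> pure_states \<and>
     invertible L \<and> loewner_le (adjoint_matrix L ** L) (mat 1) \<and>
     density_matrix \<rho>A \<and> density_matrix \<rho>B \<and>
     (\<forall>a\<in>S. \<exists>(p::real) \<Psi>. p > 0 \<and> \<Psi> \<in> pure_states \<and>
        L *v tensor_vec a b = complex_of_real p *s \<Psi> \<and>
        ptrace_B (ketbra \<Psi>) = \<rho>A \<and> ptrace_A (ketbra \<Psi>) = \<rho>B)"

lemma cinner_self: "cinner v v = complex_of_real ((norm v)\<^sup>2)"
proof -
  have "(norm v)\<^sup>2 = (\<Sum>i\<in>UNIV. (cmod (v $ i))\<^sup>2)"
    by (simp add: norm_vec_def L2_set_def sum_nonneg)
  then show ?thesis
    by (simp only: cinner_def of_real_sum complex_norm_square mult.commute)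
qed

lemma cinner_adjoint_matrix: "cinner (adjoint_matrix A *v u) v = cinner u (A *v v)"
proof -
  have "cinner (adjoint_matrix A *v u) v
      = (\<Sum>i\<in>UNIV. \<Sum>j\<in>UNIV. A $ j $ i * cnj (u $ j) * v $ i)"
    by (simp add: cinner_def adjoint_matrix_def matrix_vector_mult_def sum_distrib_right)
  also have "\<dots> = (\<Sum>j\<in>UNIV. \<Sum>i\<in>UNIV. A $ j $ i * cnj (u $ j) * v $ i)"
    by (rule sum.swap)
  also have "\<dots> = cinner u (A *v v)"
    by (simp add: cinner_def matrix_vector_mult_def sum_distrib_left mult_ac)
  finally show ?thesis .
qed

lemma cinner_tensor_vec:
  "cinner (tensor_vec a b) (tensor_vec c d) = cinner a c * cinner b d"
  unfolding cinner_def tensor_vec_def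
  by (simp add: sum_product sum.cartesian_product UNIV_Times_UNIV[symmetric]
      case_prod_beta mult_ac del: UNIV_Times_UNIV)

end

(*
  Regard the vectors of the tensor product as r x s matrices. If the masker exists,
  a \<mapsto> X a = L (a \<otimes> b) is linear with X a (X a)^* a positive multiple of rho_A for all a \<noteq> 0.
  By polarization, X a' (X a)^* is a multiple of rho_A for all a, a', so for independent
  a, a' some w = a' - t a is nonzero with X w (X a)^* = 0. Its squared Hilbert-Schmidt norm
  is the Hilbert-Schmidt inner product of the B-marginals of X w and X a, which is a positive
  multiple of the squared norm of rho_B; hence rho_B = 0, contradicting trace 1.
*)
theory Submission
  imports Defs
begin

text \<open>With \<open>u\<close>, \<open>v\<close> read as r x s matrices \<open>U\<close>,
  \<open>V\<close>, this is \<open>U V^*\<close>, the partial trace over the second factor of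
  \<open>|u><v|\<close>. Allowing \<open>u\<close> and \<open>v\<close> to differ is what makes
  polarization available.\<close>

definition cross_marginal_A ::
  "complex ^ ('r::finite \<times> 's::finite) \<Rightarrow> complex ^ ('r \<times> 's) \<Rightarrow> complex ^ 'r ^ 'r" where
  "cross_marginal_A u v = (\<chi> i j. \<Sum>k\<in>UNIV. u $ (i, k) * cnj (v $ (j, k)))"

text \<open>In the same reading this is \<open>U^T\<close> times the entrywise conjugate of
  \<open>V\<close>, the partial trace over the first factor of \<open>|u><v|\<close>.\<close>

definition cross_marginal_B ::
  "complex ^ ('r::finite \<times> 's::finite) \<Rightarrow> complex ^ ('r \<times> 's) \<Rightarrow> complex ^ 's ^ 's" where
  "cross_marginal_B u v = (\<chi> i j. \<Sum>k\<in>UNIV. u $ (k, i) * cnj (v $ (k, j)))"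

lemma ptrace_B_ketbra: "ptrace_B (ketbra \<psi>) = cross_marginal_A \<psi> \<psi>"
  by (simp add: ptrace_B_def ketbra_def cross_marginal_A_def vec_eq_iff)

lemma ptrace_A_ketbra: "ptrace_A (ketbra \<psi>) = cross_marginal_B \<psi> \<psi>"
  by (simp add: ptrace_A_def ketbra_def cross_marginal_B_def vec_eq_iff)

lemma cross_marginal_A_sesquilinear:
  "cross_marginal_A (u + u') v $ i $ j = cross_marginal_A u v $ i $ j + cross_marginal_A u' v $ i $ j"
  "cross_marginal_A u (v + v') $ i $ j = cross_marginal_A u v $ i $ j + cross_marginal_A u v' $ i $ j"
  "cross_marginal_A (c *s u) v $ i $ j = c * cross_marginal_A u v $ i $ j"
  "cross_marginal_A u (c *s v) $ i $ j = cnj c * cross_marginal_A u v $ i $ j"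
  by (simp_all add: cross_marginal_A_def algebra_simps sum.distrib sum_distrib_left)

lemma cross_marginal_B_scale:
  "cross_marginal_B (c *s u) (d *s v) $ i $ j = c * cnj d * cross_marginal_B u v $ i $ j"
  by (simp add: cross_marginal_B_def algebra_simps sum_distrib_left)

text \<open>Both sides expand to \<open>tr (W X\<^sup>* X W\<^sup>*)\<close> for the matrices \<open>W\<close>, \<open>X\<close> of \<open>w\<close>, \<open>x\<close>.\<close>

lemma sum_norm_cross_marginal_A:
  "(\<Sum>i\<in>UNIV. \<Sum>j\<in>UNIV. cross_marginal_A w x $ i $ j * cnj (cross_marginal_A w x $ i $ j))
   = (\<Sum>k\<in>UNIV. \<Sum>l\<in>UNIV. cross_marginal_B w w $ k $ l * cnj (cross_marginal_B x x $ k $ l))"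
proof -
  let ?t = "\<lambda>i j k l. w $ (i, k) * cnj (x $ (j, k)) * (cnj (w $ (i, l)) * x $ (j, l))"
  have "(\<Sum>i\<in>UNIV. \<Sum>j\<in>UNIV. cross_marginal_A w x $ i $ j * cnj (cross_marginal_A w x $ i $ j))
      = (\<Sum>i\<in>UNIV. \<Sum>j\<in>UNIV. \<Sum>k\<in>UNIV. \<Sum>l\<in>UNIV. ?t i j k l)"
    by (simp add: cross_marginal_A_def sum_product)
  also have "\<dots> = (\<Sum>i\<in>UNIV. \<Sum>k\<in>UNIV. \<Sum>j\<in>UNIV. \<Sum>l\<in>UNIV. ?t i j k l)"
    by (intro sum.cong refl sum.swap)
  also have "\<dots> = (\<Sum>k\<in>UNIV. \<Sum>i\<in>UNIV. \<Sum>j\<in>UNIV. \<Sum>l\<in>UNIV. ?t i j k l)"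
    by (rule sum.swap)
  also have "\<dots> = (\<Sum>k\<in>UNIV. \<Sum>i\<in>UNIV. \<Sum>l\<in>UNIV. \<Sum>j\<in>UNIV. ?t i j k l)"
    by (intro sum.cong refl sum.swap)
  also have "\<dots> = (\<Sum>k\<in>UNIV. \<Sum>l\<in>UNIV. \<Sum>i\<in>UNIV. \<Sum>j\<in>UNIV. ?t i j k l)"
    by (intro sum.cong refl sum.swap)
  also have "\<dots> = (\<Sum>k\<in>UNIV. \<Sum>l\<in>UNIV. cross_marginal_B w w $ k $ l * cnj (cross_marginal_B x x $ k $ l))"
    by (simp add: cross_marginal_B_def sum_product mult_ac)
  finally show ?thesis .
qed

text \<open>The sum is the squared Hilbert-Schmidt norm of \<open>A\<close>.\<close>

lemma sum_mult_cnj_eq_0_iff: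
  fixes A :: "complex ^ 'n ^ 'm"
  shows "(\<Sum>i\<in>UNIV. \<Sum>j\<in>UNIV. A $ i $ j * cnj (A $ i $ j)) = 0 \<longleftrightarrow> A = 0"
proof -
  have "(\<Sum>i\<in>UNIV. \<Sum>j\<in>UNIV. A $ i $ j * cnj (A $ i $ j))
      = complex_of_real (\<Sum>i\<in>UNIV. \<Sum>j\<in>UNIV. (cmod (A $ i $ j))\<^sup>2)"
    by (simp only: of_real_sum complex_norm_square)
  then show ?thesis
    by (simp only: of_real_eq_0_iff) (simp add: sum_nonneg_eq_0_iff sum_nonneg vec_eq_iff)
qed

lemma masked_image_add:
  "L *v tensor_vec (a + a') b = L *v tensor_vec a b + L *v tensor_vec a' b"
proof -
  have "tensor_vec (a + a') b = tensor_vec a b + tensor_vec a' b"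
    by (simp add: tensor_vec_def vec_eq_iff distrib_right)
  then show ?thesis
    by (simp only: matrix_vector_right_distrib)
qed

lemma masked_image_scale: "L *v tensor_vec (c *s a) b = c *s (L *v tensor_vec a b)"
proof -
  have "tensor_vec (c *s a) b = c *s tensor_vec a b"
    by (simp add: tensor_vec_def vec_eq_iff)
  then show ?thesis
    by (simp only: vector_scalar_commute)
qed

text \<open>The masker speaks of unit vectors only, but linear combinations are not normalized.
  Normalizing \<open>a\<close> gives \<open>v\<close> as \<open>norm a * p\<close> times a masked
  state, and marginals scale by the squared modulus of that factor.\<close>

lemma masker_marginals:
  fixes a :: "complex ^ 'r::finite" and b :: "complex ^ 's::finite"
  assumes masker: "probabilistic_masker pure_states b L \<rho>A \<rho>B" and "a \<noteq> 0"
  defines "v \<equiv> L *v tensor_vec a b"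
  shows "\<exists>c::real > 0.
    (\<forall>i j. cross_marginal_A v v $ i $ j = complex_of_real c * \<rho>A $ i $ j) \<and>
    (\<forall>k l. cross_marginal_B v v $ k $ l = complex_of_real c * \<rho>B $ k $ l)"
proof -
  define u where "u = (1 / norm a) *\<^sub>R a"
  have "u \<in> pure_states"
    using \<open>a \<noteq> 0\<close> by (simp add: u_def pure_states_def)
  then obtain p \<Psi> where p: "p > 0" "L *v tensor_vec u b = complex_of_real p *s \<Psi>"
    "ptrace_B (ketbra \<Psi>) = \<rho>A" "ptrace_A (ketbra \<Psi>) = \<rho>B"
    using masker unfolding probabilistic_masker_def by blast
  have "a = complex_of_real (norm a) *s u"
    using \<open>a \<noteq> 0\<close> by (simp add: u_def vec_eq_iff scaleR_conv_of_real[where 'a = complex])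
  then have "v = complex_of_real (norm a) *s (complex_of_real p *s \<Psi>)"
    unfolding v_def by (metis masked_image_scale p(2))
  then have v: "v = complex_of_real (norm a * p) *s \<Psi>"
    by simp
  have "cross_marginal_A \<Psi> \<Psi> = \<rho>A" "cross_marginal_B \<Psi> \<Psi> = \<rho>B"
    using p(3,4) by (simp_all only: ptrace_A_ketbra ptrace_B_ketbra)
  moreover have "(norm a * p)\<^sup>2 > 0"
    using \<open>a \<noteq> 0\<close> p(1) by simp
  ultimately show ?thesis
    unfolding v cross_marginal_A_sesquilinear cross_marginal_B_scale
    by (intro exI[of _ "(norm a * p)\<^sup>2"]) (simp add: power2_eq_square)
qed

text \<open>Polarization: the marginals of the images of \<open>x\<close>, \<open>y\<close>,
  \<open>x + y\<close> and \<open>x + \<i> *s y\<close> are all multiples of \<open>\<rho>A\<close>,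
  and they determine the cross term. The assumptions keep these four vectors nonzero, so that
  \<open>masker_marginals\<close> applies to each.\<close>

lemma masker_cross_marginal:
  fixes b :: "complex ^ 's::finite" and x y :: "complex ^ 'r::finite"
  assumes masker: "probabilistic_masker pure_states b L \<rho>A \<rho>B"
    and nonzero: "x \<noteq> 0" "y \<noteq> 0" "x + y \<noteq> 0" "x + \<i> *s y \<noteq> 0"
  obtains \<mu> where "\<And>i j. cross_marginal_A (L *v tensor_vec y b) (L *v tensor_vec x b) $ i $ j
    = \<mu> * \<rho>A $ i $ j"
proof -
  let ?u = "L *v tensor_vec x b" and ?v = "L *v tensor_vec y b"
  obtain c0 where c0: "\<And>i j. cross_marginal_A ?u ?u $ i $ j = complex_of_real c0 * \<rho>A $ i $ j"
    using masker_marginals[OF masker nonzero(1)] by blast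
  obtain c1 where c1: "\<And>i j. cross_marginal_A ?v ?v $ i $ j = complex_of_real c1 * \<rho>A $ i $ j"
    using masker_marginals[OF masker nonzero(2)] by blast
  obtain c2 where c2: "\<And>i j. cross_marginal_A (?u + ?v) (?u + ?v) $ i $ j
      = complex_of_real c2 * \<rho>A $ i $ j"
    using masker_marginals[OF masker nonzero(3)] unfolding masked_image_add by blast
  obtain c3 where c3: "\<And>i j. cross_marginal_A (?u + \<i> *s ?v) (?u + \<i> *s ?v) $ i $ j
      = complex_of_real c3 * \<rho>A $ i $ j"
    using masker_marginals[OF masker nonzero(4)] unfolding masked_image_add masked_image_scale
    by blast
  \<comment> \<open>These are the multiples of \<open>\<rho>A\<close> left for the mixed terms once
    the diagonal ones are subtracted; \<open>c1\<close> enters \<open>t\<close> unchanged because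
    \<open>\<i> * cnj \<i> = 1\<close>.\<close>
  define s t where "s = complex_of_real (c2 - c0 - c1)" and "t = complex_of_real (c3 - c0 - c1)"
  have "cross_marginal_A ?v ?u $ i $ j = (s - \<i> * t) / 2 * \<rho>A $ i $ j" for i j
  proof -
    let ?p = "cross_marginal_A ?v ?u $ i $ j" and ?q = "cross_marginal_A ?u ?v $ i $ j"
    have 1: "?p + ?q = s * \<rho>A $ i $ j"
      using c2[of i j] by (simp add: cross_marginal_A_sesquilinear c0 c1 s_def algebra_simps)
    have 2: "\<i> * ?p - \<i> * ?q = t * \<rho>A $ i $ j"
      using c3[of i j] by (simp add: cross_marginal_A_sesquilinear c0 c1 t_def algebra_simps)
    \<comment> \<open>Multiplying by \<open>- \<i>\<close> turns the second combination into
      \<open>?p - ?q\<close>, so \<open>?q\<close> cancels.\<close>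
    have "2 * ?p = (?p + ?q) - \<i> * (\<i> * ?p - \<i> * ?q)"
      by (simp add: algebra_simps)
    also have "\<dots> = (s - \<i> * t) * \<rho>A $ i $ j"
      unfolding 1 2 by (simp add: algebra_simps)
    finally show ?thesis
      by (simp add: field_simps)
  qed
  then show thesis
    by (rule that)
qed

theorem theorem2:
  assumes "CARD('r::finite) \<ge> 2" and "CARD('s::finite) \<ge> 2"
  shows "\<not> (\<exists>(b :: complex ^ 's) (L :: complex ^ ('r \<times> 's) ^ ('r \<times> 's))
              (\<rho>A :: complex ^ 'r ^ 'r) (\<rho>B :: complex ^ 's ^ 's).
            probabilistic_masker (pure_states :: (complex ^ 'r) set) b L \<rho>A \<rho>B)"
proof
  assume "\<exists>(b :: complex ^ 's) (L :: complex ^ ('r \<times> 's) ^ ('r \<times> 's))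
              (\<rho>A :: complex ^ 'r ^ 'r) (\<rho>B :: complex ^ 's ^ 's).
            probabilistic_masker (pure_states :: (complex ^ 'r) set) b L \<rho>A \<rho>B"
  then obtain b :: "complex ^ 's" and L :: "complex ^ ('r \<times> 's) ^ ('r \<times> 's)"
    and \<rho>A :: "complex ^ 'r ^ 'r" and \<rho>B :: "complex ^ 's ^ 's"
    where masker: "probabilistic_masker (pure_states :: (complex ^ 'r) set) b L \<rho>A \<rho>B"
    by blast
  \<comment> \<open>Dimension at least 2 provides two independent basis vectors.\<close>
  obtain m n :: 'r where "m \<noteq> n"
    using assms(1) by (metis (full_types) card_2_iff' ex_card)
  define x y :: "complex ^ 'r" where "x = axis m 1" and "y = axis n 1"
  have independent: "c *s x + d *s y \<noteq> 0" if "c \<noteq> 0 \<or> d \<noteq> 0" for c d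
  proof
    assume 0: "c *s x + d *s y = 0"
    have "c = (c *s x + d *s y) $ m" "d = (c *s x + d *s y) $ n"
      using \<open>m \<noteq> n\<close> by (simp_all add: x_def y_def axis_def)
    with that show False
      unfolding 0 zero_index by blast
  qed
  have nonzero: "x \<noteq> 0" "y \<noteq> 0" "x + y \<noteq> 0" "x + \<i> *s y \<noteq> 0"
    using independent[of 1 0] independent[of 0 1] independent[of 1 1] independent[of 1 \<i>] by auto
  let ?X = "\<lambda>a. L *v tensor_vec a b"
  obtain \<mu> where \<mu>: "\<And>i j. cross_marginal_A (?X y) (?X x) $ i $ j = \<mu> * \<rho>A $ i $ j"
    using masker_cross_marginal[OF masker nonzero] by blast
  obtain c where c: "c > 0"
    "\<And>i j. cross_marginal_A (?X x) (?X x) $ i $ j = complex_of_real c * \<rho>A $ i $ j"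
    "\<And>i j. cross_marginal_B (?X x) (?X x) $ i $ j = complex_of_real c * \<rho>B $ i $ j"
    using masker_marginals[OF masker nonzero(1)] by blast
  \<comment> \<open>The coefficient of \<open>x\<close> makes the cross term of \<open>?X w\<close>
    with \<open>?X x\<close> vanish: it equals \<open>(- \<mu> / c) * c + \<mu> = 0\<close> times
    \<open>\<rho>A\<close>.\<close>
  define w where "w = (- \<mu> / c) *s x + y"
  have "w \<noteq> 0"
    using independent[of "- \<mu> / c" 1] by (simp add: w_def)
  then obtain d where d: "d > 0"
    "\<And>i j. cross_marginal_B (?X w) (?X w) $ i $ j = complex_of_real d * \<rho>B $ i $ j"
    using masker_marginals[OF masker] by blast
  have "cross_marginal_A (?X w) (?X x) = 0"
    using c(1) unfolding vec_eq_iff w_def masked_image_add masked_image_scale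
      cross_marginal_A_sesquilinear \<mu> c(2) by simp
  \<comment> \<open>The squared Hilbert-Schmidt norm of the vanishing cross term, expressed through
    the marginals on the second factor.\<close>
  then have "0 = (\<Sum>k\<in>UNIV. \<Sum>l\<in>UNIV. cross_marginal_B (?X w) (?X w) $ k $ l
      * cnj (cross_marginal_B (?X x) (?X x) $ k $ l))"
    by (simp flip: sum_norm_cross_marginal_A)
  also have "\<dots> = complex_of_real (d * c) * (\<Sum>k\<in>UNIV. \<Sum>l\<in>UNIV. \<rho>B $ k $ l * cnj (\<rho>B $ k $ l))"
    by (simp add: c(3) d(2) sum_distrib_left mult_ac)
  \<comment> \<open>The factor \<open>d * c\<close> is positive, so the squared norm of
    \<open>\<rho>B\<close> itself must vanish.\<close>
  finally have "\<rho>B = 0"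
    using c(1) d(1) sum_mult_cnj_eq_0_iff[of \<rho>B] by simp
  moreover have "trace \<rho>B = 1"
    using masker by (simp add: probabilistic_masker_def density_matrix_def)
  ultimately show False
    by (simp add: trace_def)
qed

end
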